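(* Let $\mathfrak q$ be a finite-dimensional Lie algebra over an algebraically closed field $\Bbbk$ of characteristic zero, and let $\varphi:\Bbbk^\times\to GL(\mathfrak q)$ be an $m$-special polynomial homomorphism, so that the deformed bracket is $[x,y]_{\langle t\rangle}=[x,y]_{(0)}+t^m[x,y]_{(m)}$. Let $D=\frac{d\varphi_t}{dt}\big|_{t=1}\in\mathfrak{gl}(\mathfrak q)$. Then (1) $[\ ,\,]_{(0)}$ and $[\ ,\,]_{(m)}$ are compatible Lie brackets on the vector space $\mathfrak q$; (2) $D$ is a semisimple near-derivation of $\mathfrak q$ and $[\ ,\,]'_D=-m[\ ,\,]_{(m)}$.
   Context: A polynomial homomorphism $\varphi:\Bbbk^\times\to GL(\mathfrak q)$, $t\mapsto\varphi_t$, is a homomorphism of algebraic groups for which $\mathfrak q=\bigoplus_{i=0}^p\mathfrak q_i$ with $\varphi_t(x_i)=t^ix_i$ for $x_i\in\mathfrak q_i$ (only non-negative weights; no compatibility with the Lie bracket is assumed). Then $Dx=\sum_i i\,x_i$ for $x=\sum_i x_i$, $x_i\in\mathfrak q_i$. The $\varphi$-deformed Lie bracket is $[x,y]_{\langle t\rangle}=\varphi_t^{-1}[\varphi_t(x),\varphi_t(y)]$, $t\in\Bbbk^\times$; in general it is a Laurent polynomial in $t$. $\varphi$ is called $m$-special ($m\ge1$) if the deformed bracket is a polynomial in $t$ with only two terms, $[x,y]_{\langle t\rangle}=[x,y]_{(0)}+t^m[x,y]_{(m)}$ for all $x,y\in\mathfrak q$, $t\in\Bbbk^\times$, with nonzero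 bilinear operations $[\ ,\,]_{(0)},[\ ,\,]_{(m)}$ on $\mathfrak q$. For $D\in\mathfrak{gl}(\mathfrak q)$: $[x,y]'_D=D([x,y])-[Dx,y]-[x,Dy]$ and $[x,y]''_D=D([x,y]'_D)-[Dx,y]'_D-[x,Dy]'_D$; $D$ is a near-derivation of $\mathfrak q$ if $[\ ,\,]''_D\in\langle[\ ,\,],[\ ,\,]'_D\rangle$ (linear span); a semisimple near-derivation is a near-derivation that is semisimple as an operator on $\mathfrak q$ and whose induced action $\psi\mapsto\psi'_D$, where $\psi'_D(x,y)=D(\psi(x,y))-\psi(Dx,y)-\psi(x,Dy)$, on the span $\langle[\ ,\,],[\ ,\,]'_D\rangle$ is semisimple. Two Lie brackets on a vector space are compatible if all their linear combinations are Lie brackets. *)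

theory Defs
  imports
    "HOL-Computational_Algebra.Polynomial"
    "HOL-Library.Function_Algebras"
    "HOL-Library.FuncSet"
begin

text \<open>
  The pointwise scalar multiplication makes maps into a vector space a vector space, the additive
  structure being the one of \<^theory>\<open>HOL-Library.Function_Algebras\<close>. Operators carry
  \<open>fun_scale scale\<close>, bilinear operations carry \<open>fun_scale (fun_scale scale)\<close>.
\<close>

definition fun_scale :: "('k \<Rightarrow> 'v \<Rightarrow> 'v) \<Rightarrow> 'k \<Rightarrow> ('a \<Rightarrow> 'v) \<Rightarrow> ('a \<Rightarrow> 'v)" where
  "fun_scale scale c f = (\<lambda>x. scale c (f x))"

definition bilinear_op ::
  "('k::field \<Rightarrow> 'v::ab_group_add \<Rightarrow> 'v) \<Rightarrow> ('v \<Rightarrow> 'v \<Rightarrow> 'v) \<Rightarrow> bool" where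
  "bilinear_op scale b \<longleftrightarrow>
     (\<forall>x. Vector_Spaces.linear scale scale (\<lambda>y. b x y)) \<and>
     (\<forall>y. Vector_Spaces.linear scale scale (\<lambda>x. b x y))"

definition lie_bracket ::
  "('k::field \<Rightarrow> 'v::ab_group_add \<Rightarrow> 'v) \<Rightarrow> ('v \<Rightarrow> 'v \<Rightarrow> 'v) \<Rightarrow> bool" where
  "lie_bracket scale b \<longleftrightarrow>
     bilinear_op scale b \<and>
     (\<forall>x. b x x = 0) \<and>
     (\<forall>x y z. b x (b y z) + b y (b z x) + b z (b x y) = 0)"

definition compatible_lie_brackets ::
  "('k::field \<Rightarrow> 'v::ab_group_add \<Rightarrow> 'v) \<Rightarrow> ('v \<Rightarrow> 'v \<Rightarrow> 'v) \<Rightarrow> ('v \<Rightarrow> 'v \<Rightarrow> 'v) \<Rightarrow> bool" where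
  "compatible_lie_brackets scale b1 b2 \<longleftrightarrow>
     lie_bracket scale b1 \<and> lie_bracket scale b2 \<and>
     (\<forall>\<alpha> \<beta>. lie_bracket scale (\<lambda>x y. scale \<alpha> (b1 x y) + scale \<beta> (b2 x y)))"


text \<open>
  Regular maps from the multiplicative group of the field to a vector space are vector-valued
  Laurent polynomials. Maps defined on the multiplicative group are represented by functions on
  the whole field whose value at \<open>0\<close> is irrelevant.
\<close>

definition laurent_expansion ::
  "('k::field \<Rightarrow> 'w::ab_group_add \<Rightarrow> 'w) \<Rightarrow> ('k \<Rightarrow> 'w) \<Rightarrow> int set \<Rightarrow> (int \<Rightarrow> 'w) \<Rightarrow> bool" where
  "laurent_expansion scale \<gamma> I c \<longleftrightarrow>
     finite I \<and> (\<forall>t. t \<noteq> 0 \<longrightarrow> \<gamma> t = (\<Sum>i\<in>I. scale (t powi i) (c i)))"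

definition regular_map ::
  "('k::field \<Rightarrow> 'w::ab_group_add \<Rightarrow> 'w) \<Rightarrow> ('k \<Rightarrow> 'w) \<Rightarrow> bool" where
  "regular_map scale \<gamma> \<longleftrightarrow> (\<exists>I c. laurent_expansion scale \<gamma> I c)"

text \<open>
  The (formal) derivative. Over an infinite field the nonzero coefficients are determined by the
  map, hence so is its derivative.
\<close>

definition has_regular_derivative ::
  "('k::field \<Rightarrow> 'w::ab_group_add \<Rightarrow> 'w) \<Rightarrow> ('k \<Rightarrow> 'w) \<Rightarrow> 'w \<Rightarrow> 'k \<Rightarrow> bool" where
  "has_regular_derivative scale \<gamma> v a \<longleftrightarrow>
     (\<exists>I c. laurent_expansion scale \<gamma> I c \<and>
            v = (\<Sum>i\<in>I. scale (of_int i * a powi (i - 1)) (c i)))"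


text \<open>
  Homomorphisms of algebraic groups from the multiplicative group to the general linear group.
  Regularity of the inverse matrices is automatic, as \<open>\<phi> t\<close> has inverse \<open>\<phi> (inverse t)\<close>.
\<close>

definition algebraic_GL_hom ::
  "('k::field \<Rightarrow> 'v::ab_group_add \<Rightarrow> 'v) \<Rightarrow> ('k \<Rightarrow> 'v \<Rightarrow> 'v) \<Rightarrow> bool" where
  "algebraic_GL_hom scale \<phi> \<longleftrightarrow>
     (\<forall>t. t \<noteq> 0 \<longrightarrow> Vector_Spaces.linear scale scale (\<phi> t) \<and> bij (\<phi> t)) \<and>
     (\<forall>s t. s \<noteq> 0 \<longrightarrow> t \<noteq> 0 \<longrightarrow> \<phi> (s * t) = \<phi> s \<circ> \<phi> t) \<and>
     regular_map (fun_scale scale) \<phi>"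

definition is_direct_sum ::
  "('k::field \<Rightarrow> 'v::ab_group_add \<Rightarrow> 'v) \<Rightarrow> (nat \<Rightarrow> 'v set) \<Rightarrow> nat \<Rightarrow> bool" where
  "is_direct_sum scale Q p \<longleftrightarrow>
     (\<forall>i\<le>p. module.subspace scale (Q i)) \<and>
     (\<forall>x. \<exists>!c. c \<in> Pi\<^sub>E {..p} Q \<and> x = (\<Sum>i\<le>p. c i))"

definition polynomial_hom ::
  "('k::field \<Rightarrow> 'v::ab_group_add \<Rightarrow> 'v) \<Rightarrow> ('k \<Rightarrow> 'v \<Rightarrow> 'v) \<Rightarrow> bool" where
  "polynomial_hom scale \<phi> \<longleftrightarrow>
     algebraic_GL_hom scale \<phi> \<and>
     (\<exists>p Q. is_direct_sum scale Q p \<and>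
            (\<forall>t i x. t \<noteq> 0 \<longrightarrow> i \<le> p \<longrightarrow> x \<in> Q i \<longrightarrow> \<phi> t x = scale (t ^ i) x))"

definition deformed_bracket ::
  "('v \<Rightarrow> 'v \<Rightarrow> 'v) \<Rightarrow> ('k \<Rightarrow> 'v \<Rightarrow> 'v) \<Rightarrow> 'k \<Rightarrow> 'v \<Rightarrow> 'v \<Rightarrow> 'v" where
  "deformed_bracket br \<phi> t x y = inv (\<phi> t) (br (\<phi> t x) (\<phi> t y))"

text \<open>
  \<open>m_special scale br \<phi> m b0 bm\<close>: the map \<open>\<phi>\<close> is \<open>m\<close>-special for the Lie bracket \<open>br\<close>, the two terms
  of the deformed bracket being \<open>b0\<close> and \<open>bm\<close>.
\<close>

definition m_special ::
  "('k::field \<Rightarrow> 'v::ab_group_add \<Rightarrow> 'v) \<Rightarrow> ('v \<Rightarrow> 'v \<Rightarrow> 'v) \<Rightarrow> ('k \<Rightarrow> 'v \<Rightarrow> 'v) \<Rightarrow> nat \<Rightarrow>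
   ('v \<Rightarrow> 'v \<Rightarrow> 'v) \<Rightarrow> ('v \<Rightarrow> 'v \<Rightarrow> 'v) \<Rightarrow> bool" where
  "m_special scale br \<phi> m b0 bm \<longleftrightarrow>
     m \<ge> 1 \<and>
     bilinear_op scale b0 \<and> b0 \<noteq> 0 \<and>
     bilinear_op scale bm \<and> bm \<noteq> 0 \<and>
     (\<forall>t x y. t \<noteq> 0 \<longrightarrow> deformed_bracket br \<phi> t x y = b0 x y + scale (t ^ m) (bm x y))"


definition op_deriv ::
  "('v::ab_group_add \<Rightarrow> 'v) \<Rightarrow> ('v \<Rightarrow> 'v \<Rightarrow> 'v) \<Rightarrow> ('v \<Rightarrow> 'v \<Rightarrow> 'v)" where
  "op_deriv D \<psi> = (\<lambda>x y. D (\<psi> x y) - \<psi> (D x) y - \<psi> x (D y))"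

definition bracket_span ::
  "('k::field \<Rightarrow> 'v::ab_group_add \<Rightarrow> 'v) \<Rightarrow> ('v \<Rightarrow> 'v \<Rightarrow> 'v) \<Rightarrow> ('v \<Rightarrow> 'v) \<Rightarrow>
   ('v \<Rightarrow> 'v \<Rightarrow> 'v) set" where
  "bracket_span scale br D = module.span (fun_scale (fun_scale scale)) {br, op_deriv D br}"

definition near_derivation ::
  "('k::field \<Rightarrow> 'v::ab_group_add \<Rightarrow> 'v) \<Rightarrow> ('v \<Rightarrow> 'v \<Rightarrow> 'v) \<Rightarrow> ('v \<Rightarrow> 'v) \<Rightarrow> bool" where
  "near_derivation scale br D \<longleftrightarrow>
     Vector_Spaces.linear scale scale D \<and>
     op_deriv D (op_deriv D br) \<in> bracket_span scale br D"

text \<open>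
  The restriction of \<open>T\<close> to the subspace \<open>S\<close> is a semisimple operator: \<open>S\<close> is \<open>T\<close>-invariant, and each
  \<open>T\<close>-invariant subspace of \<open>S\<close> has a \<open>T\<close>-invariant complement in \<open>S\<close>.
\<close>

definition semisimple_on ::
  "('k::field \<Rightarrow> 'w::ab_group_add \<Rightarrow> 'w) \<Rightarrow> 'w set \<Rightarrow> ('w \<Rightarrow> 'w) \<Rightarrow> bool" where
  "semisimple_on scale S T \<longleftrightarrow>
     Vector_Spaces.linear scale scale T \<and> module.subspace scale S \<and> T ` S \<subseteq> S \<and>
     (\<forall>U. module.subspace scale U \<and> U \<subseteq> S \<and> T ` U \<subseteq> U \<longrightarrow>
       (\<exists>W. module.subspace scale W \<and> W \<subseteq> S \<and> T ` W \<subseteq> W \<and>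
            U \<inter> W = {0} \<and> {u + w | u w. u \<in> U \<and> w \<in> W} = S))"

definition semisimple_near_derivation ::
  "('k::field \<Rightarrow> 'v::ab_group_add \<Rightarrow> 'v) \<Rightarrow> ('v \<Rightarrow> 'v \<Rightarrow> 'v) \<Rightarrow> ('v \<Rightarrow> 'v) \<Rightarrow> bool" where
  "semisimple_near_derivation scale br D \<longleftrightarrow>
     near_derivation scale br D \<and>
     semisimple_on scale UNIV D \<and>
     semisimple_on (fun_scale (fun_scale scale)) (bracket_span scale br D) (op_deriv D)"

end

theory Submission
  imports Defs
begin

text \<open>
  The homomorphism \<open>\<phi>\<close> acts on bilinear operations by \<open>\<psi> \<mapsto> inv (\<phi> t) (\<psi> (\<phi> t x) (\<phi> t y))\<close>, and the
  deformed brackets are the orbit of \<open>br\<close> under this action. That the orbit is \<open>b0 + t ^ m \<cdot> bm\<close> says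
  that \<open>br = b0 + bm\<close> is the decomposition of \<open>br\<close> into weight vectors: \<open>b0\<close> has weight \<open>0\<close> and \<open>bm\<close>
  has weight \<open>m\<close> (\<open>m_special_homogeneous\<close>). The infinitesimal action of \<open>D\<close> is \<open>- op_deriv D\<close>, hence
  \<open>b0\<close> and \<open>bm\<close> are eigenvectors of \<open>op_deriv D\<close> with eigenvalues \<open>0\<close> and \<open>- m\<close>
  (\<open>op_deriv_homogeneous\<close>). In particular \<open>op_deriv D br = - m \<cdot> bm\<close>, and the span of \<open>br\<close> and
  \<open>op_deriv D br\<close> is the span of the eigenvectors \<open>b0\<close> and \<open>bm\<close>. It is invariant, so that \<open>D\<close> is a
  near-derivation, and \<open>op_deriv D\<close> is semisimple on it. Likewise \<open>D\<close> is semisimple because the weight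
  spaces of \<open>\<phi>\<close> consist of eigenvectors of \<open>D\<close> and span the whole space
  (\<open>semisimple_on_span_eigenvectors\<close>).

  Compatibility is independent of this. All the deformed brackets are Lie brackets, being isomorphic
  to \<open>br\<close>, and the Jacobi identity for \<open>b0 + t ^ m \<cdot> bm\<close> is a polynomial identity in \<open>t\<close>, whose
  coefficients yield the Jacobi identity for every combination of \<open>b0\<close> and \<open>bm\<close>
  (\<open>compatible_lie_brackets_of_pencil\<close>).

  Everything passes between identities in \<open>t\<close> and their coefficients by the linear independence of the
  powers of \<open>t\<close> over a vector space in characteristic zero (\<open>laurent_coeffs_zero\<close>). It also makes the
  derivative of a regular map unique, so that an identity between regular maps can be differentiated
  by applying the sum and product rules to both sides.
\<close>

section \<open>Spaces of operators and bilinear operations\<close>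

lemma vector_space_fun_scale:
  assumes "vector_space scale"
  shows "vector_space (fun_scale scale)"
proof -
  interpret vector_space scale by (fact assms)
  show ?thesis
    by unfold_locales (auto simp: fun_scale_def fun_eq_iff scale_right_distrib scale_left_distrib)
qed

locale char0_vector_space = vector_space scale
  for scale :: "'k::field_char_0 \<Rightarrow> 'v::ab_group_add \<Rightarrow> 'v"
begin

lemma linearI:
  assumes "\<And>x y. f (x + y) = f x + f y" and "\<And>c x. f (scale c x) = scale c (f x)"
  shows "Vector_Spaces.linear scale scale f"
  using assms by unfold_locales auto

lemma linear_simps:
  assumes "Vector_Spaces.linear scale scale f"
  shows "f (x + y) = f x + f y" "f (scale c x) = scale c (f x)" "f (x - y) = f x - f y"
    "f (- x) = - f x" "f 0 = 0" "f (\<Sum>i\<in>A. h i) = (\<Sum>i\<in>A. f (h i))"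
proof -
  interpret f: Vector_Spaces.linear scale scale f by (fact assms)
  show "f (x + y) = f x + f y" "f (scale c x) = scale c (f x)" "f (x - y) = f x - f y"
    "f (- x) = - f x" "f 0 = 0" "f (\<Sum>i\<in>A. h i) = (\<Sum>i\<in>A. f (h i))"
    by (simp_all add: f.add f.scale f.diff f.neg f.sum)
qed

lemma bilinear_opD:
  assumes "bilinear_op scale b"
  shows "Vector_Spaces.linear scale scale (b x)"
    and "Vector_Spaces.linear scale scale (\<lambda>x. b x y)"
  using assms by (simp_all add: bilinear_op_def)

lemmas bilinear_simps =
  linear_simps[OF bilinear_opD(1)] linear_simps[OF bilinear_opD(2)]


section \<open>Calculus of vector-valued Laurent polynomials\<close>

lemma two_powi_eq_iff: "(2::'k) powi i = 2 powi j \<longleftrightarrow> i = j"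
proof -
  have *: "i = j" if "i \<le> j" "(2::'k) powi i = 2 powi j" for i j :: int
  proof -
    obtain n where j: "j = i + int n" using \<open>i \<le> j\<close> zle_iff_zadd by blast
    from that(2) have "(2::'k) ^ n = 1"
      by (simp add: j power_int_add)
    then have "of_nat (2 ^ n) = (of_nat 1 :: 'k)" by simp
    then have "(2::nat) ^ n = 1" by (simp only: of_nat_eq_iff)
    then show "i = j" by (simp add: j)
  qed
  show ?thesis
    using *[of i j] *[of j i] by (cases "i \<le> j") auto
qed

text \<open>
  The substitution of \<open>2 * t\<close> for \<open>t\<close> multiplies the term of weight \<open>i\<close> by \<open>2 powi i\<close>. In
  characteristic zero these factors are distinct, so that the combination \<open>\<gamma> (2 * t) - 2 powi j \<cdot> \<gamma> t\<close>
  kills exactly the term of weight \<open>j\<close>. This settles the independence of the powers of \<open>t\<close> without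
  coordinates.
\<close>

lemma laurent_coeffs_zero:
  assumes "finite I"
    and "\<And>t. t \<noteq> 0 \<Longrightarrow> (\<Sum>i\<in>I. scale (t powi i) (c i)) = 0"
    and "i \<in> I"
  shows "c i = 0"
  using assms
proof (induction I arbitrary: c i rule: finite_induct)
  case empty
  then show ?case by simp
next
  case (insert j I)
  have expand: "scale (t powi j) (c j) + (\<Sum>i\<in>I. scale (t powi i) (c i)) = 0" if "t \<noteq> 0" for t
    using insert.prems(1)[OF that] insert.hyps by simp
  have "(\<Sum>i\<in>I. scale (t powi i) (scale (2 powi i - 2 powi j) (c i))) = 0" if "t \<noteq> 0" for t
  proof -
    have "(\<Sum>i\<in>I. scale (t powi i) (scale (2 powi i - 2 powi j) (c i)))
        = (\<Sum>i\<in>I. scale ((2 * t) powi i) (c i)) - scale (2 powi j) (\<Sum>i\<in>I. scale (t powi i) (c i))"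
      by (simp add: scale_sum_right sum_subtractf[symmetric] power_int_mult_distrib
          scale_left_diff_distrib algebra_simps)
    \<comment> \<open>By \<open>expand\<close> at \<open>2 * t\<close> and at \<open>t\<close>, both sums reduce to the term of weight \<open>j\<close>.\<close>
    also have "\<dots> = - scale ((2 * t) powi j) (c j) + scale (2 powi j) (scale (t powi j) (c j))"
    proof -
      have "(\<Sum>i\<in>I. scale ((2 * t) powi i) (c i)) = - scale ((2 * t) powi j) (c j)"
        using expand[of "2 * t"] that by (simp add: add_eq_0_iff)
      moreover have "(\<Sum>i\<in>I. scale (t powi i) (c i)) = - scale (t powi j) (c j)"
        using expand[OF that] by (simp add: add_eq_0_iff)
      ultimately show ?thesis by simp
    qed
    also have "\<dots> = 0"
      by (simp add: power_int_mult_distrib)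
    finally show ?thesis .
  qed
  then have "scale (2 powi i - 2 powi j) (c i) = 0" if "i \<in> I" for i
    using insert.IH[of "\<lambda>i. scale (2 powi i - 2 powi j) (c i)"] that by blast
  then have rest: "c i = 0" if "i \<in> I" for i
    using that insert.hyps by (auto simp: two_powi_eq_iff)
  have "c j = 0"
    using expand[of 1] rest by simp
  then show ?case
    using rest insert.prems(2) by auto
qed

lemma three_term_coeffs_zero:
  assumes "m \<ge> 1"
    and "\<And>t. t \<noteq> 0 \<Longrightarrow> u + scale (t ^ m) v + scale (t ^ (2 * m)) w = 0"
  shows "u = 0" "v = 0" "w = 0"
proof -
  define c where "c i = (if i = 0 then u else if i = int m then v else w)" for i :: int
  have "(\<Sum>i\<in>{0, int m, int (2 * m)}. scale (t powi i) (c i)) = 0" if "t \<noteq> 0" for t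
    using assms(2)[OF that] \<open>m \<ge> 1\<close>
    by (simp add: c_def add.assoc del: of_nat_mult)
  then have "c i = 0" if "i \<in> {0, int m, int (2 * m)}" for i
    using laurent_coeffs_zero[of "{0, int m, int (2 * m)}" c i] that by blast
  from this[of 0] this[of "int m"] this[of "int (2 * m)"] show "u = 0" "v = 0" "w = 0"
    using \<open>m \<ge> 1\<close> by (simp_all add: c_def)
qed

lemma two_term_coeffs_zero:
  assumes "m \<ge> 1" and "\<And>t. t \<noteq> 0 \<Longrightarrow> u + scale (t ^ m) v = 0"
  shows "u = 0" "v = 0"
  using three_term_coeffs_zero[of m u v 0] assms by auto

text \<open>
  Sums of monomials whose weights may repeat arise from products of expansions; collecting the terms
  of equal weight turns them into expansions.
\<close>

lemma has_regular_derivative_weighted_sum: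
  assumes "finite S" and "\<And>t. t \<noteq> 0 \<Longrightarrow> \<gamma> t = (\<Sum>s\<in>S. scale (t powi w s) (c s))"
  shows "has_regular_derivative scale \<gamma> (\<Sum>s\<in>S. scale (of_int (w s) * a powi (w s - 1)) (c s)) a"
proof -
  define d where "d i = (\<Sum>s\<in>{s\<in>S. w s = i}. c s)" for i
  have collect: "(\<Sum>s\<in>S. scale (f (w s)) (c s)) = (\<Sum>i\<in>w ` S. scale (f i) (d i))" for f
    unfolding d_def scale_sum_right
    by (subst sum.image_gen[OF \<open>finite S\<close>, of _ w]) (auto intro!: sum.cong)
  have "laurent_expansion scale \<gamma> (w ` S) d"
    unfolding laurent_expansion_def
    using assms collect[of "\<lambda>i. _ powi i"] by auto
  then show ?thesis
    unfolding has_regular_derivative_def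
    using collect[of "\<lambda>i. of_int i * a powi (i - 1)"] by blast
qed

lemma has_regular_derivative_cong:
  assumes "has_regular_derivative scale \<gamma> v a" and "\<And>t. t \<noteq> 0 \<Longrightarrow> \<delta> t = \<gamma> t"
  shows "has_regular_derivative scale \<delta> v a"
  using assms by (auto simp: has_regular_derivative_def laurent_expansion_def)

lemma has_regular_derivative_add:
  assumes "has_regular_derivative scale \<gamma> u a" and "has_regular_derivative scale \<delta> v a"
  shows "has_regular_derivative scale (\<lambda>t. \<gamma> t + \<delta> t) (u + v) a"
proof -
  obtain I c J d where c: "laurent_expansion scale \<gamma> I c"
      "u = (\<Sum>i\<in>I. scale (of_int i * a powi (i - 1)) (c i))"
    and d: "laurent_expansion scale \<delta> J d"
      "v = (\<Sum>i\<in>J. scale (of_int i * a powi (i - 1)) (d i))"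
    using assms unfolding has_regular_derivative_def by blast
  have fin: "finite I" "finite J"
    using c d by (auto simp: laurent_expansion_def)
  \<comment> \<open>Keeping the two index sets apart avoids extending the coefficients by zero to their union.\<close>
  define w where "w = case_sum (\<lambda>i::int. i) (\<lambda>j::int. j)"
  have "\<gamma> t + \<delta> t = (\<Sum>s\<in>I <+> J. scale (t powi w s) (case_sum c d s))" if "t \<noteq> 0" for t
    using c d that fin by (simp add: laurent_expansion_def sum.Plus w_def)
  from has_regular_derivative_weighted_sum[OF _ this, of a] show ?thesis
    using c d fin by (simp add: sum.Plus w_def)
qed

lemma has_regular_derivative_scale:
  assumes "has_regular_derivative scale \<gamma> v a"
  shows "has_regular_derivative scale (\<lambda>t. scale r (\<gamma> t)) (scale r v) a"
proof -
  obtain I c where c: "laurent_expansion scale \<gamma> I c"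
      "v = (\<Sum>i\<in>I. scale (of_int i * a powi (i - 1)) (c i))"
    using assms unfolding has_regular_derivative_def by blast
  then have "laurent_expansion scale (\<lambda>t. scale r (\<gamma> t)) I (\<lambda>i. scale r (c i))"
    by (auto simp: laurent_expansion_def scale_sum_right mult.commute)
  moreover have "scale r v = (\<Sum>i\<in>I. scale (of_int i * a powi (i - 1)) (scale r (c i)))"
    by (simp add: c scale_sum_right mult.commute)
  ultimately show ?thesis
    unfolding has_regular_derivative_def by blast
qed

text \<open>
  The difference of two expansions of \<open>\<gamma>\<close> is an expansion of \<open>0\<close>, and its coefficients vanish.
\<close>

lemma has_regular_derivative_unique:
  assumes "has_regular_derivative scale \<gamma> u a" and "has_regular_derivative scale \<gamma> v a"
  shows "u = v"
proof -
  have "has_regular_derivative scale (\<lambda>t. \<gamma> t + scale (- 1) (\<gamma> t)) (u + scale (- 1) v) a"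
    by (intro has_regular_derivative_add has_regular_derivative_scale assms)
  then obtain I c where I: "finite I"
    and zero: "\<And>t. t \<noteq> 0 \<Longrightarrow> (\<Sum>i\<in>I. scale (t powi i) (c i)) = 0"
    and diff: "u - v = (\<Sum>i\<in>I. scale (of_int i * a powi (i - 1)) (c i))"
    unfolding has_regular_derivative_def laurent_expansion_def by auto
  have "c i = 0" if "i \<in> I" for i
    using laurent_coeffs_zero[OF I zero that] .
  then show ?thesis
    using diff by simp
qed

lemma has_regular_derivative_power_scale:
  "has_regular_derivative scale (\<lambda>t. scale (t ^ n) v) (scale (of_nat n) v) 1"
  using has_regular_derivative_weighted_sum[of "{()}" "\<lambda>t. scale (t ^ n) v" "\<lambda>_. int n" "\<lambda>_. v" 1]
  by simp

lemma has_regular_derivative_power_mult: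
  assumes "has_regular_derivative scale \<gamma> v 1"
  shows "has_regular_derivative scale (\<lambda>t. scale (t ^ n) (\<gamma> t)) (scale (of_nat n) (\<gamma> 1) + v) 1"
proof -
  obtain I c where I: "finite I"
    and c: "\<And>t. t \<noteq> 0 \<Longrightarrow> \<gamma> t = (\<Sum>i\<in>I. scale (t powi i) (c i))"
    and v: "v = (\<Sum>i\<in>I. scale (of_int i) (c i))"
    using assms unfolding has_regular_derivative_def laurent_expansion_def by auto
  have "scale (t ^ n) (\<gamma> t) = (\<Sum>i\<in>I. scale (t powi (int n + i)) (c i))" if "t \<noteq> 0" for t
    using that by (simp add: c scale_sum_right power_int_add)
  from has_regular_derivative_weighted_sum[OF I this, of 1] show ?thesis
    by (simp add: c v scale_sum_right scale_left_distrib sum.distrib)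
qed

lemma has_regular_derivative_bilinear:
  assumes b: "bilinear_op scale b"
    and "has_regular_derivative scale \<gamma> u 1" and "has_regular_derivative scale \<delta> v 1"
  shows "has_regular_derivative scale (\<lambda>t. b (\<gamma> t) (\<delta> t)) (b u (\<delta> 1) + b (\<gamma> 1) v) 1"
proof -
  obtain I c J d where I: "finite I" and J: "finite J"
    and c: "\<And>t. t \<noteq> 0 \<Longrightarrow> \<gamma> t = (\<Sum>i\<in>I. scale (t powi i) (c i))"
    and d: "\<And>t. t \<noteq> 0 \<Longrightarrow> \<delta> t = (\<Sum>j\<in>J. scale (t powi j) (d j))"
    and u: "u = (\<Sum>i\<in>I. scale (of_int i) (c i))"
    and v: "v = (\<Sum>j\<in>J. scale (of_int j) (d j))"
    using assms(2,3) unfolding has_regular_derivative_def laurent_expansion_def by auto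
  have double_sum: "b (\<Sum>i\<in>I. scale (f i) (c i)) (\<Sum>j\<in>J. scale (g j) (d j))
      = (\<Sum>(i, j)\<in>I \<times> J. scale (f i * g j) (b (c i) (d j)))" for f g
    unfolding sum.cartesian_product[symmetric]
    by (simp add: bilinear_simps[OF b] scale_sum_right)
       (rule trans[OF sum.swap], simp add: mult.commute)
  have "b (\<gamma> t) (\<delta> t) = (\<Sum>s\<in>I \<times> J. scale (t powi (fst s + snd s)) (b (c (fst s)) (d (snd s))))"
    if "t \<noteq> 0" for t
    using that by (simp add: c d double_sum power_int_add case_prod_beta)
  from has_regular_derivative_weighted_sum[OF _ this, of 1]
  have "has_regular_derivative scale (\<lambda>t. b (\<gamma> t) (\<delta> t))
      (\<Sum>s\<in>I \<times> J. scale (of_int (fst s + snd s)) (b (c (fst s)) (d (snd s)))) 1"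
    using I J by simp
  moreover have "b u (\<delta> 1) + b (\<gamma> 1) v
      = (\<Sum>s\<in>I \<times> J. scale (of_int (fst s + snd s)) (b (c (fst s)) (d (snd s))))"
    using double_sum[of of_int "\<lambda>_. 1"] double_sum[of "\<lambda>_. 1" of_int]
    by (simp add: c d u v case_prod_beta sum.distrib[symmetric] scale_left_distrib)
  ultimately show ?thesis by simp
qed

lemma has_regular_derivative_eval:
  assumes "has_regular_derivative (fun_scale scale) \<phi> D a"
  shows "has_regular_derivative scale (\<lambda>t. \<phi> t x) (D x) a"
proof -
  have apply_sum: "(\<Sum>i\<in>I. fun_scale scale (f i) (c i)) x = (\<Sum>i\<in>I. scale (f i) (c i x))"
    for I f and c :: "int \<Rightarrow> 'a \<Rightarrow> 'v"
    by (induction I rule: infinite_finite_induct) (auto simp: fun_scale_def)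
  obtain I c where "laurent_expansion (fun_scale scale) \<phi> I c"
      "D = (\<Sum>i\<in>I. fun_scale scale (of_int i * a powi (i - 1)) (c i))"
    using assms unfolding has_regular_derivative_def by blast
  then have "laurent_expansion scale (\<lambda>t. \<phi> t x) I (\<lambda>i. c i x)"
      "D x = (\<Sum>i\<in>I. scale (of_int i * a powi (i - 1)) (c i x))"
    by (auto simp: laurent_expansion_def apply_sum)
  then show ?thesis
    unfolding has_regular_derivative_def by blast
qed

text \<open>
  The coefficients of an expansion of \<open>\<phi>\<close> are arbitrary maps, so that linearity comes from
  differentiating the identities \<open>\<phi> t (x + y) = \<phi> t x + \<phi> t y\<close> and \<open>\<phi> t (r x) = r \<phi> t x\<close>.
\<close>

lemma linear_derivative:
  assumes "has_regular_derivative (fun_scale scale) \<phi> D a"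
    and lin: "\<And>t. t \<noteq> 0 \<Longrightarrow> Vector_Spaces.linear scale scale (\<phi> t)"
  shows "Vector_Spaces.linear scale scale D"
proof (rule linearI)
  note deriv = has_regular_derivative_eval[OF assms(1)]
  show "D (x + y) = D x + D y" for x y
    by (rule has_regular_derivative_unique[OF deriv]
        has_regular_derivative_cong[OF has_regular_derivative_add[OF deriv deriv]])+
       (simp add: linear_simps[OF lin])
  show "D (scale r x) = scale r (D x)" for r x
    by (rule has_regular_derivative_unique[OF deriv]
        has_regular_derivative_cong[OF has_regular_derivative_scale[OF deriv]])+
       (simp add: linear_simps[OF lin])
qed

text \<open>
  The derivative at \<open>1\<close> of the two expressions for \<open>\<phi> t x\<close>.
\<close>

lemma derivative_weight_vector:
  assumes "has_regular_derivative (fun_scale scale) \<phi> D 1"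
    and "\<And>t. t \<noteq> 0 \<Longrightarrow> \<phi> t x = scale (t ^ n) x"
  shows "D x = scale (of_nat n) x"
  by (rule has_regular_derivative_unique[OF has_regular_derivative_eval[OF assms(1)]
      has_regular_derivative_cong[OF has_regular_derivative_power_scale]])
     (rule assms(2))

text \<open>
  Differentiating the homogeneity relation at \<open>1\<close>, the product rule gives \<open>b (D x) y + b x (D y)\<close> on the
  left and \<open>n \<cdot> b x y + D (b x y)\<close> on the right.
\<close>

lemma op_deriv_homogeneous:
  assumes b: "bilinear_op scale b"
    and D: "has_regular_derivative (fun_scale scale) \<phi> D 1" and one: "\<phi> 1 = id"
    and hom: "\<And>t x y. t \<noteq> 0 \<Longrightarrow> b (\<phi> t x) (\<phi> t y) = scale (t ^ n) (\<phi> t (b x y))"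
  shows "op_deriv D b = fun_scale (fun_scale scale) (- of_nat n) b"
proof (intro ext)
  fix x y
  note deriv = has_regular_derivative_eval[OF D]
  have "has_regular_derivative scale (\<lambda>t. b (\<phi> t x) (\<phi> t y)) (b (D x) y + b x (D y)) 1"
    using has_regular_derivative_bilinear[OF b deriv deriv, of x y] by (simp add: one)
  moreover have "has_regular_derivative scale (\<lambda>t. b (\<phi> t x) (\<phi> t y))
      (scale (of_nat n) (b x y) + D (b x y)) 1"
    using has_regular_derivative_cong[OF has_regular_derivative_power_mult[OF deriv], OF hom]
    by (simp add: one)
  ultimately have "b (D x) y + b x (D y) = scale (of_nat n) (b x y) + D (b x y)"
    by (rule has_regular_derivative_unique)
  then show "op_deriv D b x y = fun_scale (fun_scale scale) (- of_nat n) b x y"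
    by (simp add: op_deriv_def fun_scale_def algebra_simps)
qed


section \<open>Semisimplicity of diagonalizable operators\<close>

text \<open>
  A basis of the subspace \<open>U\<close> extends to a basis of \<open>span E\<close> by elements of \<open>E\<close>. These are
  eigenvectors, so that their span is an invariant complement of \<open>U\<close>.
\<close>

lemma semisimple_on_span_eigenvectors:
  assumes T: "Vector_Spaces.linear scale scale T"
    and eigen: "\<And>e. e \<in> E \<Longrightarrow> \<exists>r. T e = scale r e"
  shows "semisimple_on scale (span E) T"
proof -
  have invariant: "T ` span C \<subseteq> span C" if "C \<subseteq> E" for C
  proof clarify
    fix x assume "x \<in> span C"
    then show "T x \<in> span C"
    proof (induction rule: span_induct_alt)
      case base
      show ?case by (simp add: linear_simps[OF T] span_zero)
    next
      case (step r e x)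
      obtain s where "T e = scale s e"
        using eigen step(1) \<open>C \<subseteq> E\<close> by blast
      then have "T (scale r e + x) = scale (r * s) e + T x"
        by (simp add: linear_simps[OF T])
      then show ?case
        using step by (simp add: span_add span_scale span_base)
    qed
  qed
  have complement: "\<exists>W. subspace W \<and> W \<subseteq> span E \<and> T ` W \<subseteq> W \<and> U \<inter> W = {0} \<and>
      {u + w | u w. u \<in> U \<and> w \<in> W} = span E"
    if U: "subspace U" "U \<subseteq> span E" for U
  proof -
    obtain A where A: "A \<subseteq> U" "independent A" "U \<subseteq> span A"
      using maximal_independent_subset by blast
    have span_A: "span A = U"
      using A U(1) span_minimal by blast
    obtain B where B: "A \<subseteq> B" "B \<subseteq> A \<union> E" "independent B" "A \<union> E \<subseteq> span B"
      using maximal_independent_subset_extend[of A "A \<union> E"] A(2) by blast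
    define C where "C = B - A"
    have "C \<subseteq> E" and B_eq: "B = A \<union> C"
      using B by (auto simp: C_def)
    have "span B = span E"
    proof (rule antisym)
      have "A \<union> E \<subseteq> span E"
        using A(1) U(2) span_superset by blast
      then have "B \<subseteq> span E" using B(2) by blast
      then show "span B \<subseteq> span E" by (simp add: span_minimal)
      show "span E \<subseteq> span B"
        using B(4) by (simp add: span_minimal)
    qed
    then have "{u + w | u w. u \<in> U \<and> w \<in> span C} = span E"
      using span_Un[of A C] by (simp add: B_eq span_A)
    moreover have "U \<inter> span C = {0}"
    proof -
      have "x = 0" if "x \<in> U" "x \<in> span C" for x
      proof -
        have "representation B x = representation A x" "representation B x = representation C x"
          using that B(1) span_A by (auto simp: C_def intro!: representation_extend[OF B(3)])
        then have "representation B x b = 0" for b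
          using representation_ne_zero[of A x b] representation_ne_zero[of C x b]
          by (auto simp: C_def)
        moreover have "x \<in> span B"
          using that B_eq span_mono[of C B] by auto
        ultimately show ?thesis
          using sum_nonzero_representation_eq[OF \<open>independent B\<close>, of x] by simp
      qed
      then show ?thesis
        using U(1) subspace_0 span_zero by auto
    qed
    ultimately show ?thesis
      using \<open>C \<subseteq> E\<close> invariant span_mono by (intro exI[of _ "span C"]) auto
  qed
  show ?thesis
    unfolding semisimple_on_def
    using T invariant[of E] complement by auto
qed

section \<open>The two terms of the deformed bracket\<close>

lemma bilinear_op_combination:
  assumes "bilinear_op scale b" and "bilinear_op scale b'"
  shows "bilinear_op scale (\<lambda>x y. scale \<alpha> (b x y) + scale \<beta> (b' x y))"
  unfolding bilinear_op_def
  by (intro conjI allI linearI)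
     (simp_all add: bilinear_simps[OF assms(1)] bilinear_simps[OF assms(2)] algebra_simps)

lemma lie_bracket_transport:
  assumes br: "lie_bracket scale br"
    and f: "Vector_Spaces.linear scale scale f" "bij f"
  shows "lie_bracket scale (\<lambda>x y. inv f (br (f x) (f y)))"
proof -
  have g: "Vector_Spaces.linear scale scale (inv f)"
    by (intro linearI; rule inv_f_eq)
       (simp_all add: f linear_simps[OF f(1)] bij_is_inj surj_f_inv_f[OF bij_is_surj])
  have bil: "bilinear_op scale br" 
    using br by (simp add: lie_bracket_def)
  have jacobi: "br x (br y z) + br y (br z x) + br z (br x y) = 0" for x y z
    using br by (simp add: lie_bracket_def)
  have "br x x = 0" for x
    using br by (simp add: lie_bracket_def)
  moreover have "f (inv f x) = x" for x
    using f(2) by (simp add: surj_f_inv_f[OF bij_is_surj])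
  ultimately show ?thesis
    unfolding lie_bracket_def bilinear_op_def
    by (auto intro!: linearI simp: linear_simps[OF f(1)] linear_simps[OF g]
        bilinear_simps[OF bil] jacobi linear_simps(1)[OF g, symmetric] simp del: linear_simps(1)[OF g])
qed

text \<open>
  The Jacobi sum of \<open>b + t ^ m \<cdot> b'\<close> is a polynomial in \<open>t ^ m\<close> of degree two, whose coefficients are
  the Jacobi sums of \<open>b\<close> and of \<open>b'\<close> and the mixed term. If it vanishes for all nonzero \<open>t\<close>, so do
  its three coefficients, and these are also the coefficients of the quadratic form in \<open>\<alpha>\<close>, \<open>\<beta>\<close> that
  is the Jacobi sum of \<open>\<alpha> b + \<beta> b'\<close>.
\<close>

lemma compatible_lie_brackets_of_pencil:
  assumes "m \<ge> 1" and b: "bilinear_op scale b" and b': "bilinear_op scale b'"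
    and lie: "\<And>t. t \<noteq> 0 \<Longrightarrow> lie_bracket scale (\<lambda>x y. b x y + scale (t ^ m) (b' x y))"
  shows "compatible_lie_brackets scale b b'"
proof -
  note bilin = bilinear_simps[OF b] bilinear_simps[OF b']
  have alternating: "b x x = 0" "b' x x = 0" for x
  proof -
    have "b x x + scale (t ^ m) (b' x x) = 0" if "t \<noteq> 0" for t
      using lie[OF that] by (simp add: lie_bracket_def)
    then show "b x x = 0" "b' x x = 0"
      using two_term_coeffs_zero[OF \<open>m \<ge> 1\<close>] by blast+
  qed
  \<comment> \<open>The Jacobi sum, polarized in the bracket so that it becomes bilinear in \<open>p\<close> and \<open>q\<close>.\<close>
  define J where "J p q x y z = p x (q y z) + p y (q z x) + p z (q x y)"
    for p q :: "'v \<Rightarrow> 'v \<Rightarrow> 'v" and x y z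
  have expand: "J (\<lambda>x y. scale \<alpha> (b x y) + scale \<beta> (b' x y))
        (\<lambda>x y. scale \<alpha> (b x y) + scale \<beta> (b' x y)) x y z
      = scale (\<alpha> * \<alpha>) (J b b x y z) + scale (\<alpha> * \<beta>) (J b b' x y z + J b' b x y z)
        + scale (\<beta> * \<beta>) (J b' b' x y z)" for \<alpha> \<beta> x y z
    unfolding J_def by (simp add: bilin algebra_simps)
  have "J b b x y z + scale (t ^ m) (J b b' x y z + J b' b x y z)
      + scale (t ^ (2 * m)) (J b' b' x y z) = 0" if "t \<noteq> 0" for t x y z
    using lie[OF that] expand[of 1 "t ^ m" x y z]
    by (simp add: lie_bracket_def J_def mult_2 power_add)
  note coeffs = three_term_coeffs_zero[OF \<open>m \<ge> 1\<close> this]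
  have pencil: "lie_bracket scale (\<lambda>x y. scale \<alpha> (b x y) + scale \<beta> (b' x y))" for \<alpha> \<beta>
    unfolding lie_bracket_def
    using bilinear_op_combination[OF b b'] expand[of \<alpha> \<beta>]
    by (simp add: alternating coeffs) (simp add: J_def)
  from pencil[of 1 0] pencil[of 0 1] pencil show ?thesis
    by (simp add: compatible_lie_brackets_def)
qed

lemma linear_op_deriv:
  assumes "Vector_Spaces.linear scale scale D"
  shows "Vector_Spaces.linear (fun_scale (fun_scale scale)) (fun_scale (fun_scale scale)) (op_deriv D)"
proof -
  interpret op: vector_space "fun_scale (fun_scale scale) :: 'k \<Rightarrow> ('v \<Rightarrow> 'v \<Rightarrow> 'v) \<Rightarrow> _"
    by (intro vector_space_fun_scale vector_space_axioms)
  show ?thesis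
    by unfold_locales
       (auto simp: op_deriv_def fun_scale_def fun_eq_iff linear_simps[OF assms] algebra_simps)
qed

text \<open>
  Deforming by \<open>\<phi> (s * t)\<close> is deforming by \<open>\<phi> s\<close> and then by \<open>\<phi> t\<close>. Hence the deformation by \<open>\<phi> t\<close>
  turns \<open>b0 + s ^ m \<cdot> bm\<close> into \<open>b0 + (s * t) ^ m \<cdot> bm\<close>, and comparing the coefficients of the powers
  of \<open>s\<close> shows how it acts on each of the two terms.
\<close>

lemma m_special_homogeneous:
  assumes lin: "\<And>t. t \<noteq> 0 \<Longrightarrow> Vector_Spaces.linear scale scale (\<phi> t)"
    and bij: "\<And>t. t \<noteq> 0 \<Longrightarrow> bij (\<phi> t)"
    and mult: "\<And>s t. s \<noteq> 0 \<Longrightarrow> t \<noteq> 0 \<Longrightarrow> \<phi> (s * t) = \<phi> s \<circ> \<phi> t"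
    and special: "m_special scale br \<phi> m b0 bm"
    and t: "t \<noteq> 0"
  shows "b0 (\<phi> t x) (\<phi> t y) = \<phi> t (b0 x y)"
    and "bm (\<phi> t x) (\<phi> t y) = scale (t ^ m) (\<phi> t (bm x y))"
proof -
  have deformed: "br (\<phi> s x) (\<phi> s y) = \<phi> s (b0 x y + scale (s ^ m) (bm x y))" if "s \<noteq> 0" for s x y
  proof -
    have "inv (\<phi> s) (br (\<phi> s x) (\<phi> s y)) = b0 x y + scale (s ^ m) (bm x y)"
      using special that by (simp add: m_special_def deformed_bracket_def)
    then show ?thesis
      using surj_f_inv_f[OF bij_is_surj[OF bij[OF that]]] by metis
  qed
  have "(b0 (\<phi> t x) (\<phi> t y) - \<phi> t (b0 x y))
      + scale (s ^ m) (bm (\<phi> t x) (\<phi> t y) - scale (t ^ m) (\<phi> t (bm x y))) = 0"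
    if s: "s \<noteq> 0" for s
  proof -
    have "\<phi> s (b0 (\<phi> t x) (\<phi> t y) + scale (s ^ m) (bm (\<phi> t x) (\<phi> t y)))
        = br (\<phi> (s * t) x) (\<phi> (s * t) y)"
      using deformed[OF s] s t by (simp add: mult)
    also have "\<dots> = \<phi> s (\<phi> t (b0 x y + scale ((s * t) ^ m) (bm x y)))"
      using deformed[of "s * t" x y] s t by (simp add: mult)
    finally have "b0 (\<phi> t x) (\<phi> t y) + scale (s ^ m) (bm (\<phi> t x) (\<phi> t y))
        = \<phi> t (b0 x y + scale ((s * t) ^ m) (bm x y))"
      using bij_is_inj[OF bij[OF s]] by (simp add: inj_eq)
    then show ?thesis
      by (simp add: linear_simps[OF lin[OF t]] power_mult_distrib algebra_simps)
  qed
  moreover have "m \<ge> 1"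
    using special by (simp add: m_special_def)
  ultimately have "b0 (\<phi> t x) (\<phi> t y) - \<phi> t (b0 x y) = 0"
      "bm (\<phi> t x) (\<phi> t y) - scale (t ^ m) (\<phi> t (bm x y)) = 0"
    using two_term_coeffs_zero by blast+
  then show "b0 (\<phi> t x) (\<phi> t y) = \<phi> t (b0 x y)"
      "bm (\<phi> t x) (\<phi> t y) = scale (t ^ m) (\<phi> t (bm x y))"
    by simp_all
qed

end


section \<open>Brackets deformed by a special homomorphism\<close>

theorem theorem6p5:
  fixes scale :: "'k::{alg_closed_field, field_char_0} \<Rightarrow> 'v::ab_group_add \<Rightarrow> 'v"
    and Basis :: "'v set"
    and br b0 bm :: "'v \<Rightarrow> 'v \<Rightarrow> 'v"
    and \<phi> :: "'k \<Rightarrow> 'v \<Rightarrow> 'v"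
    and m :: nat
    and D :: "'v \<Rightarrow> 'v"
  assumes "finite_dimensional_vector_space scale Basis"
    and "lie_bracket scale br"
    and "polynomial_hom scale \<phi>"
    and "m_special scale br \<phi> m b0 bm"
    and "has_regular_derivative (fun_scale scale) \<phi> D 1"
  shows "compatible_lie_brackets scale b0 bm \<and>
         semisimple_near_derivation scale br D \<and>
         op_deriv D br = (\<lambda>x y. - scale (of_nat m) (bm x y))"
proof -
  interpret finite_dimensional_vector_space scale Basis by (fact assms(1))
  interpret char0_vector_space scale ..
  interpret op: char0_vector_space "fun_scale (fun_scale scale) :: 'k \<Rightarrow> ('v \<Rightarrow> 'v \<Rightarrow> 'v) \<Rightarrow> _"
    by (intro char0_vector_space.intro vector_space_fun_scale vector_space_axioms)
  let ?scale = "fun_scale (fun_scale scale) :: 'k \<Rightarrow> ('v \<Rightarrow> 'v \<Rightarrow> 'v) \<Rightarrow> 'v \<Rightarrow> 'v \<Rightarrow> 'v"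

  have lin: "Vector_Spaces.linear scale scale (\<phi> t)" and bij: "bij (\<phi> t)" if "t \<noteq> 0" for t
    using assms(3) that by (auto simp: polynomial_hom_def algebraic_GL_hom_def)
  have mult: "\<phi> (s * t) = \<phi> s \<circ> \<phi> t" if "s \<noteq> 0" "t \<noteq> 0" for s t
    using assms(3) that by (auto simp: polynomial_hom_def algebraic_GL_hom_def)
  have one: "\<phi> 1 = id"
  proof
    fix x
    have "\<phi> 1 (\<phi> 1 x) = \<phi> 1 x"
      using mult[of 1 1] by (simp add: fun_eq_iff)
    then show "\<phi> 1 x = id x"
      using bij_is_inj[OF bij[of 1]] by (simp add: inj_eq)
  qed
  have m: "m \<ge> 1" and b0: "bilinear_op scale b0" and bm: "bilinear_op scale bm"
    and deformed: "\<And>t x y. t \<noteq> 0 \<Longrightarrow>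
      inv (\<phi> t) (br (\<phi> t x) (\<phi> t y)) = b0 x y + scale (t ^ m) (bm x y)"
    using assms(4) by (auto simp: m_special_def deformed_bracket_def)
  have linear_D: "Vector_Spaces.linear scale scale D"
    using linear_derivative[OF assms(5)] lin by blast

  have compatible: "compatible_lie_brackets scale b0 bm"
  proof (rule compatible_lie_brackets_of_pencil[OF m b0 bm])
    fix t :: 'k assume t: "t \<noteq> 0"
    show "lie_bracket scale (\<lambda>x y. b0 x y + scale (t ^ m) (bm x y))"
      using lie_bracket_transport[OF assms(2) lin[OF t] bij[OF t]] by (simp add: deformed[OF t])
  qed

  have br_eq: "br = b0 + bm"
    using deformed[of 1] by (simp add: fun_eq_iff one)
  note homogeneous = m_special_homogeneous[OF lin bij mult assms(4)]
  have D_b0: "op_deriv D b0 = ?scale 0 b0"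
    using op_deriv_homogeneous[OF b0 assms(5) one, of 0] homogeneous(1) by simp
  have D_bm: "op_deriv D bm = ?scale (- of_nat m) bm"
    using op_deriv_homogeneous[OF bm assms(5) one, of m] homogeneous(2) by simp
  note linear_op = linear_op_deriv[OF linear_D]
  have D_br: "op_deriv D br = ?scale (- of_nat m) bm"
    by (simp add: br_eq op.linear_simps[OF linear_op] D_b0 D_bm)

  have span_eq: "bracket_span scale br D = op.span {b0, bm}"
    unfolding bracket_span_def D_br
  proof (rule antisym)
    show "op.span {br, ?scale (- of_nat m) bm} \<subseteq> op.span {b0, bm}"
      by (rule op.span_minimal)
         (auto simp: br_eq intro!: op.span_add op.span_neg op.span_scale intro: op.span_base)
    \<comment> \<open>As \<open>m \<ge> 1\<close> is invertible in characteristic zero, \<open>bm\<close> is a multiple of \<open>op_deriv D br\<close>.\<close>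
    have bm': "bm = ?scale (- inverse (of_nat m)) (?scale (- of_nat m) bm)"
      using m by simp
    have "bm \<in> op.span {br, ?scale (- of_nat m) bm}"
      by (subst bm') (intro op.span_scale op.span_base, simp)
    moreover have "br \<in> op.span {br, ?scale (- of_nat m) bm}"
      by (intro op.span_base) simp
    ultimately have "bm \<in> op.span {br, ?scale (- of_nat m) bm}"
      and "br - bm \<in> op.span {br, ?scale (- of_nat m) bm}"
      by (auto intro: op.span_diff)
    then show "op.span {b0, bm} \<subseteq> op.span {br, ?scale (- of_nat m) bm}"
      by (intro op.span_minimal) (auto simp: br_eq)
  qed

  have "op_deriv D (op_deriv D br) \<in> bracket_span scale br D"
    unfolding span_eq D_br op.linear_simps(2)[OF linear_op] D_bm
    by (intro op.span_scale op.span_base) simp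
  then have near: "near_derivation scale br D"
    by (simp add: near_derivation_def linear_D)

  have "semisimple_on scale UNIV D"
  proof -
    define E where "E = {x. \<exists>r. D x = scale r x}"
    obtain p Q where Q: "is_direct_sum scale Q p"
      and weight: "\<And>t i x. t \<noteq> 0 \<Longrightarrow> i \<le> p \<Longrightarrow> x \<in> Q i \<Longrightarrow> \<phi> t x = scale (t ^ i) x"
      using assms(3) by (auto simp: polynomial_hom_def)
    have "x \<in> span E" for x
    proof -
      obtain c where c: "c \<in> Pi\<^sub>E {..p} Q" and x: "x = (\<Sum>i\<le>p. c i)"
        using Q unfolding is_direct_sum_def by blast
      have "c i \<in> E" if "i \<le> p" for i
        using derivative_weight_vector[OF assms(5) weight[OF _ that]] PiE_mem[OF c] that
        by (auto simp: E_def)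
      then show ?thesis
        unfolding x by (intro span_sum span_base) simp
    qed
    then have "span E = UNIV" by auto
    then show ?thesis
      using semisimple_on_span_eigenvectors[OF linear_D, of E] by (simp add: E_def)
  qed
  moreover have "semisimple_on ?scale (bracket_span scale br D) (op_deriv D)"
    unfolding span_eq
    by (rule op.semisimple_on_span_eigenvectors[OF linear_op]) (use D_b0 D_bm in blast)
  ultimately have "semisimple_near_derivation scale br D"
    using near by (simp add: semisimple_near_derivation_def)
  moreover have "op_deriv D br = (\<lambda>x y. - scale (of_nat m) (bm x y))"
    by (simp add: D_br fun_scale_def)
  ultimately show ?thesis
    using compatible by blast
qed

end
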